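(* For positive integers $m,\nu$, let $A(m,\nu)$ be the number of $n$-colour self-inverse compositions of $\nu$ into exactly $m$ parts. Then for all positive integers $m,\nu$: (i) if $m>1$, $$A(2m-1,2\nu-1)=\sum_{l=1}^{\nu-1}(2l-1)\binom{\nu+m-l-2}{2m-3};$$ (ii) $$A(2m,2\nu)=\binom{\nu+m-1}{2m-1};$$ (iii) if $m>1$, $$A(2m-1,2\nu)=\sum_{l=1}^{\nu-1}2l\binom{\nu+m-l-2}{2m-3}.$$
   Context: An $n$-colour composition of a positive integer $\nu$ is a finite ordered sequence of coloured parts $(h_1)_{t_1}(h_2)_{t_2}\cdots(h_m)_{t_m}$ with each $h_i\ge 1$ an integer, $h_1+\cdots+h_m=\nu$, and each colour $t_i\in\{1,\dots,h_i\}$ (so a part of size $h$ comes in $h$ different colours); $m$ is its number of parts. It is self-inverse if the sequence of coloured parts read from left to right is identical with the sequence read from right to left, i.e. $h_i=h_{m+1-i}$ and $t_i=t_{m+1-i}$ for all $i$. Binomial coefficients $\binom{n}{k}$ with $0\le n<k$ are $0$, and empty sums are $0$. *)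

theory Defs
  imports Complex_Main
begin

text \<open>A coloured part \<open>h\<^sub>t\<close> is the pair \<open>(h, t)\<close> of its size and its colour.\<close>

type_synonym coloured_part = "nat \<times> nat"

definition n_colour_composition :: "nat \<Rightarrow> coloured_part list \<Rightarrow> bool" where
  "n_colour_composition \<nu> c \<longleftrightarrow>
     (\<forall>(h, t) \<in> set c. 1 \<le> h \<and> 1 \<le> t \<and> t \<le> h) \<and> sum_list (map fst c) = \<nu>"

definition self_inverse :: "coloured_part list \<Rightarrow> bool" where
  "self_inverse c \<longleftrightarrow> rev c = c"

definition num_self_inverse :: "nat \<Rightarrow> nat \<Rightarrow> nat" where
  "num_self_inverse m \<nu> =
     card {c. n_colour_composition \<nu> c \<and> self_inverse c \<and> length c = m}"

end

theory Submission
  imports Defs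
begin

text \<open>
  A palindrome is determined by its first half, together with its central entry if its length is
  odd. So everything reduces to counting all \<open>n\<close>-colour compositions of \<open>k\<close> into \<open>j\<close> parts. A part
  \<open>(h, t)\<close> is the same as the pair of natural numbers \<open>(t - 1, h - t)\<close>, whose sum is \<open>h - 1\<close>; hence
  such compositions correspond to lists of \<open>2 j\<close> natural numbers with sum \<open>k - j\<close>, and stars and
  bars gives the count \<open>(k + j - 1) choose (2 j - 1)\<close> (lemma \<open>card_colour_comps\<close>).

  An even-length palindrome of \<open>2 \<nu>\<close> has a first half of sum \<open>\<nu>\<close>, which gives the formula for
  even length. In an odd-length palindrome the central size has the parity of the total. Writing the total as
  \<open>2 \<nu> - r\<close> and the central size as \<open>2 l - r\<close> with \<open>r \<in> {0, 1}\<close>, the first half has sum \<open>\<nu> - l\<close>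
  and the centre can be coloured in \<open>2 l - r\<close> ways, which treats the two remaining formulas at once
  (lemma \<open>num_self_inverse_odd\<close>). The term \<open>l = \<nu>\<close> asks for a first half of sum \<open>0\<close> and so
  vanishes when there is more than one part.
\<close>

definition colour_comps :: "nat \<Rightarrow> nat \<Rightarrow> coloured_part list set" where
  "colour_comps j k = {c. n_colour_composition k c \<and> length c = j}"

text \<open>
  This inverts the splitting of each part \<open>(h, t)\<close> into the two entries \<open>t - 1\<close> and \<open>h - t\<close>. On
  lists of odd length the last entry is ignored; only even lengths matter.
\<close>

fun parts_of_gaps :: "nat list \<Rightarrow> coloured_part list" where
  "parts_of_gaps (a # b # xs) = (a + b + 1, a + 1) # parts_of_gaps xs"
| "parts_of_gaps _ = []"

fun gaps_of_parts :: "coloured_part list \<Rightarrow> nat list" where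
  "gaps_of_parts ((h, t) # c) = (t - 1) # (h - t) # gaps_of_parts c"
| "gaps_of_parts [] = []"

lemma parts_of_gaps_in_colour_comps:
  assumes "length xs = 2 * j"
  shows "parts_of_gaps xs \<in> colour_comps j (sum_list xs + j)"
  using assms
proof (induction xs arbitrary: j rule: parts_of_gaps.induct)
  case (1 a b xs)
  then obtain i where "j = Suc i" "length xs = 2 * i"
    by (cases j) auto
  with "1.IH"[of i] show ?case
    by (auto simp: colour_comps_def n_colour_composition_def)
qed (auto simp: colour_comps_def n_colour_composition_def)

lemma gaps_of_parts_of_gaps:
  "even (length xs) \<Longrightarrow> gaps_of_parts (parts_of_gaps xs) = xs"
  by (induction xs rule: parts_of_gaps.induct) auto

lemma gaps_of_parts_inverse:
  assumes "c \<in> colour_comps j k"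
  shows "parts_of_gaps (gaps_of_parts c) = c \<and> length (gaps_of_parts c) = 2 * j
    \<and> sum_list (gaps_of_parts c) + j = k"
  using assms
proof (induction c arbitrary: j k rule: gaps_of_parts.induct)
  case (1 h t c)
  have "1 \<le> t" "t \<le> h" "c \<in> colour_comps (j - 1) (k - h)" "1 \<le> j" "h \<le> k"
    using "1.prems" by (auto simp: colour_comps_def n_colour_composition_def)
  with "1.IH"[of "j - 1" "k - h"] show ?case
    by auto
qed (auto simp: colour_comps_def n_colour_composition_def)

lemma bij_betw_parts_of_gaps:
  "bij_betw parts_of_gaps {xs. length xs = 2 * j \<and> sum_list xs + j = k} (colour_comps j k)"
  by (rule bij_betw_byWitness[where f' = gaps_of_parts])
    (use parts_of_gaps_in_colour_comps in \<open>auto simp: gaps_of_parts_of_gaps gaps_of_parts_inverse\<close>)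

text \<open>
  Stars and bars on the \<open>2 j\<close> gaps, which sum to \<open>k - j\<close>. If \<open>k < j\<close> there are no compositions,
  and the binomial coefficient vanishes as well because \<open>k + j - 1 < 2 j - 1\<close>.
\<close>

lemma card_colour_comps:
  assumes "1 \<le> j"
  shows "card (colour_comps j k) = (k + j - 1) choose (2 * j - 1)"
proof (cases "j \<le> k")
  case True
  have "card (colour_comps j k) = card {xs. length xs = 2 * j \<and> sum_list xs + j = k}"
    using bij_betw_same_card[OF bij_betw_parts_of_gaps] by metis
  also have "{xs. length xs = 2 * j \<and> sum_list xs + j = k} =
      {xs. length xs = 2 * j \<and> sum_list xs = k - j}"
    using True by auto
  also have "card \<dots> = (k - j + 2 * j - 1) choose (k - j)"
    by (rule card_length_sum_list)
  also have "\<dots> = (k - j + 2 * j - 1) choose (2 * j - 1)"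
    using assms binomial_symmetric[of "k - j" "k - j + 2 * j - 1"] by simp
  also have "k - j + 2 * j - 1 = k + j - 1"
    using True by simp
  finally show ?thesis .
next
  case False
  have "{xs :: nat list. length xs = 2 * j \<and> sum_list xs + j = k} = {}"
    using False by auto
  then have "colour_comps j k = {}"
    using bij_betw_parts_of_gaps[of j k] by (metis bij_betw_empty1)
  with False show ?thesis
    by (simp add: binomial_eq_0)
qed

lemma finite_colour_comps: "finite (colour_comps j k)"
proof -
  \<comment> \<open>An infinite set also has \<open>card\<close> \<open>0\<close>, so finiteness does not follow from the count.\<close>
  have "{xs. length xs = 2 * j \<and> sum_list xs + j = k} \<subseteq> {xs. set xs \<subseteq> {..k} \<and> length xs = 2 * j}"
    using member_le_sum_list by fastforce
  then have "finite {xs. length xs = 2 * j \<and> sum_list xs + j = k}"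
    by (rule finite_subset) (simp add: finite_lists_length_eq)
  then show ?thesis
    using bij_betw_finite[OF bij_betw_parts_of_gaps] by blast
qed

lemma palindrome_drop:
  assumes "rev c = c" "k \<le> length c"
  shows "drop (length c - k) c = rev (take k c)"
  using assms by (metis rev_rev_ident take_rev)

lemma num_self_inverse_even:
  "num_self_inverse (2 * j) (2 * k) = card (colour_comps j k)"
proof -
  have "bij_betw (\<lambda>d. d @ rev d) (colour_comps j k)
    {c. n_colour_composition (2 * k) c \<and> self_inverse c \<and> length c = 2 * j}"
  proof (rule bij_betw_imageI)
    show "inj_on (\<lambda>d. d @ rev d) (colour_comps j k)"
      by (auto simp: inj_on_def colour_comps_def)
    show "(\<lambda>d. d @ rev d) ` colour_comps j k =
      {c. n_colour_composition (2 * k) c \<and> self_inverse c \<and> length c = 2 * j}" (is "_ = ?P")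
    proof (intro equalityI subsetI)
      fix c assume c: "c \<in> ?P"
      define d where "d = take j c"
      have "c = d @ rev d"
        using c palindrome_drop[of c j] unfolding d_def self_inverse_def
        by (metis (mono_tags, lifting) add_diff_cancel_left' append_take_drop_id le_add1
            mem_Collect_eq mult_2)
      moreover from this c have "d \<in> colour_comps j k"
        by (auto simp: colour_comps_def n_colour_composition_def rev_map[symmetric])
      ultimately show "c \<in> (\<lambda>d. d @ rev d) ` colour_comps j k"
        by blast
    qed (auto simp: colour_comps_def n_colour_composition_def self_inverse_def rev_map[symmetric])
  qed
  then show ?thesis
    unfolding num_self_inverse_def by (simp add: bij_betw_same_card)
qed

text \<open>
  Splitting a palindrome into its first half \<open>d\<close> and its centre \<open>(2 l - r, t)\<close>. Here \<open>r\<close> is the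
  parity of the total: it forces the centre to have the same parity, and \<open>\<nu> - l\<close> is what remains
  for each half.
\<close>

lemma num_self_inverse_odd:
  assumes r: "r \<le> 1"
  shows "num_self_inverse (2 * j + 1) (2 * \<nu> - r) =
    (\<Sum>l = 1..\<nu>. (2 * l - r) * card (colour_comps j (\<nu> - l)))"
proof -
  let ?S = "SIGMA l:{1..\<nu>}. {1..2 * l - r} \<times> colour_comps j (\<nu> - l)"
  let ?P = "{c. n_colour_composition (2 * \<nu> - r) c \<and> self_inverse c \<and> length c = 2 * j + 1}"
  let ?f = "\<lambda>(l, t, d). d @ (2 * l - r, t) # rev d"
  have "bij_betw ?f ?S ?P"
  proof (rule bij_betw_imageI)
    show "inj_on ?f ?S"
      using r by (auto simp: inj_on_def colour_comps_def)
    show "?f ` ?S = ?P"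
    proof (intro equalityI subsetI)
      fix c assume "c \<in> ?f ` ?S"
      then show "c \<in> ?P"
        using r
        by (auto simp: colour_comps_def n_colour_composition_def self_inverse_def rev_map[symmetric])
    next
      fix c assume c: "c \<in> ?P"
      define d where "d = take j c"
      obtain h t where ht: "c ! j = (h, t)"
        by fastforce
      \<comment> \<open>The index of the centre is \<open>j\<close>, so the second half starts at \<open>Suc j = length c - j\<close>.\<close>
      have "drop (Suc j) c = rev d"
        using c palindrome_drop[of c j] by (simp add: d_def self_inverse_def)
      moreover have "c = take j c @ c ! j # drop (Suc j) c"
        using c by (intro id_take_nth_drop) simp
      ultimately have c_eq: "c = d @ (h, t) # rev d"
        using ht by (simp add: d_def)
      define s where "s = sum_list (map fst d)"
      have total: "2 * s + h = 2 * \<nu> - r"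
        using c unfolding c_eq s_def by (simp add: n_colour_composition_def rev_map[symmetric])
      have "1 \<le> t" "t \<le> h" and d: "d \<in> colour_comps j s"
        using c unfolding c_eq by (auto simp: colour_comps_def n_colour_composition_def s_def)
      moreover have "1 \<le> \<nu> - s" "\<nu> - s \<le> \<nu>" "2 * (\<nu> - s) - r = h" "\<nu> - (\<nu> - s) = s"
        using total r \<open>1 \<le> t\<close> \<open>t \<le> h\<close> by auto
      ultimately have "(\<nu> - s, t, d) \<in> ?S" "?f (\<nu> - s, t, d) = c"
        using c_eq by auto
      then show "c \<in> ?f ` ?S"
        by (metis (no_types, lifting) image_eqI)
    qed
  qed
  then have "num_self_inverse (2 * j + 1) (2 * \<nu> - r) = card ?S"
    unfolding num_self_inverse_def by (simp add: bij_betw_same_card)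
  also have "\<dots> = (\<Sum>l = 1..\<nu>. (2 * l - r) * card (colour_comps j (\<nu> - l)))"
    by (simp add: card_SigmaI finite_colour_comps card_cartesian_product)
  finally show ?thesis .
qed

lemma num_self_inverse_odd_binomial:
  assumes "r \<le> 1" "1 < m" "1 \<le> \<nu>"
  shows "num_self_inverse (2 * m - 1) (2 * \<nu> - r) =
    (\<Sum>l = 1..\<nu> - 1. (2 * l - r) * ((\<nu> + m - l - 2) choose (2 * m - 3)))"
proof -
  have count: "card (colour_comps (m - 1) (\<nu> - l)) = (\<nu> + m - l - 2) choose (2 * m - 3)"
    if "l \<le> \<nu>" for l
  proof -
    have "\<nu> - l + (m - 1) - 1 = \<nu> + m - l - 2" "2 * (m - 1) - 1 = 2 * m - 3"
      using that assms by auto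
    then show ?thesis
      using card_colour_comps[of "m - 1" "\<nu> - l"] assms by simp
  qed
  have "num_self_inverse (2 * m - 1) (2 * \<nu> - r) =
      num_self_inverse (2 * (m - 1) + 1) (2 * \<nu> - r)"
    using assms by (intro arg_cong2[where f = num_self_inverse]) auto
  also have "\<dots> = (\<Sum>l = 1..\<nu>. (2 * l - r) * card (colour_comps (m - 1) (\<nu> - l)))"
    by (rule num_self_inverse_odd) fact
  also have "\<dots> = (\<Sum>l = 1..\<nu>. (2 * l - r) * ((\<nu> + m - l - 2) choose (2 * m - 3)))"
    by (intro sum.cong refl) (simp only: count atLeastAtMost_iff)
  \<comment> \<open>At \<open>l = \<nu>\<close> the coefficient is \<open>(m - 2) choose (2 m - 3)\<close>, which is \<open>0\<close> for \<open>m > 1\<close>.\<close>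
  also have "\<dots> = (\<Sum>l = 1..\<nu> - 1. (2 * l - r) * ((\<nu> + m - l - 2) choose (2 * m - 3)))"
    using assms by (intro sum.mono_neutral_right) (auto simp: binomial_eq_0)
  finally show ?thesis .
qed

theorem theorem2p1:
  fixes m \<nu> :: nat
  assumes "m \<ge> 1" and "\<nu> \<ge> 1"
  shows "(m > 1 \<longrightarrow>
            num_self_inverse (2 * m - 1) (2 * \<nu> - 1)
              = (\<Sum>l = 1..\<nu> - 1. (2 * l - 1) * ((\<nu> + m - l - 2) choose (2 * m - 3))))
       \<and> num_self_inverse (2 * m) (2 * \<nu>) = (\<nu> + m - 1) choose (2 * m - 1)
       \<and> (m > 1 \<longrightarrow>
            num_self_inverse (2 * m - 1) (2 * \<nu>)
              = (\<Sum>l = 1..\<nu> - 1. 2 * l * ((\<nu> + m - l - 2) choose (2 * m - 3))))"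
  using num_self_inverse_odd_binomial[of 1 m \<nu>] num_self_inverse_odd_binomial[of 0 m \<nu>]
    num_self_inverse_even[of m \<nu>] card_colour_comps[of m \<nu>] assms
  by simp

end
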